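(* Let $A\subset B$ be a finite ring extension of integral domains, with fields of fractions $K$ and $L$, respectively. (a) $A\subset B$ is free if and only if $[L:K]=\mu_A(B)$. (b) $A\subset B$ is free and $K\subset L$ is a simple field extension if and only if $\mathrm{d}_K(L)=\mathrm{d}_A(B)=\mu_A(B)$.
   Context: All rings are commutative with unity. A ring extension $A\subset B$ is finite if $B$ is a finitely generated $A$-module, and free if $B$ is a free $A$-module. For an integral ring extension $A\subset B$ of integral domains and $b\in B$, the integral degree of $b$ over $A$, denoted $\mathrm{id}_A(b)$, is the minimum integer $n\geq 1$ such that $b$ is a root of a monic polynomial of degree $n$ in $A[T]$. The integral degree of $B$ over $A$ is $\mathrm{d}_A(B)=\sup\{\mathrm{id}_A(b)\mid b\in B\}$ (possibly $\infty$); the same definition applies to the algebraic field extension $K\subset L$, giving $\mathrm{d}_K(L)$. $\mu_A(B)$ denotes the minimal number of generators of $B$ as an $A$-module. A field extension $K\subset L$ is simple if $L=K(\alpha)$ for some $\alpha\in L$. *)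

theory Defs
  imports
    "HOL-Computational_Algebra.Computational_Algebra"
    "HOL-Library.Extended_Nat"
begin

text \<open>
  A ring extension \<open>A \<subset> B\<close> is given by two types \<open>'a\<close> (for \<open>A\<close>) and \<open>'b\<close> (for \<open>B\<close>) and an
  injective unital ring homomorphism \<open>\<iota>\<close> from \<open>'a\<close> to \<open>'b\<close>, through which \<open>'a\<close> is regarded
  as a subring of \<open>'b\<close>. The same definitions serve for field extensions.
\<close>

locale ring_extension =
  fixes \<iota> :: "'a::comm_ring_1 \<Rightarrow> 'b::comm_ring_1"
  assumes ext_add: "\<iota> (x + y) = \<iota> x + \<iota> y"
    and ext_mult: "\<iota> (x * y) = \<iota> x * \<iota> y"
    and ext_one: "\<iota> 1 = 1"
    and ext_inj: "inj \<iota>"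

definition ext_scale :: "('a::comm_ring_1 \<Rightarrow> 'b::comm_ring_1) \<Rightarrow> 'a \<Rightarrow> 'b \<Rightarrow> 'b"
  where "ext_scale \<iota> a x = \<iota> a * x"

definition finite_extension :: "('a::comm_ring_1 \<Rightarrow> 'b::comm_ring_1) \<Rightarrow> bool"
  where "finite_extension \<iota> \<longleftrightarrow> (\<exists>S. finite S \<and> module.span (ext_scale \<iota>) S = UNIV)"

definition free_extension :: "('a::comm_ring_1 \<Rightarrow> 'b::comm_ring_1) \<Rightarrow> bool"
  where "free_extension \<iota> \<longleftrightarrow>
    (\<exists>S. \<not> module.dependent (ext_scale \<iota>) S \<and> module.span (ext_scale \<iota>) S = UNIV)"

text \<open>\<open>\<mu>\<^sub>A(B)\<close>; it is \<open>\<infinity>\<close> (the infimum of the empty set) if \<open>B\<close> is not finitely generated.\<close>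

definition min_generators :: "('a::comm_ring_1 \<Rightarrow> 'b::comm_ring_1) \<Rightarrow> enat"
  where "min_generators \<iota> =
    (INF S \<in> {S. finite S \<and> module.span (ext_scale \<iota>) S = UNIV}. enat (card S))"

text \<open>\<open>id\<^sub>A(b)\<close>; it is \<open>\<infinity>\<close> if \<open>b\<close> is not integral over \<open>A\<close>.\<close>

definition elem_integral_degree :: "('a::comm_ring_1 \<Rightarrow> 'b::comm_ring_1) \<Rightarrow> 'b \<Rightarrow> enat"
  where "elem_integral_degree \<iota> b =
    (INF p \<in> {p :: 'a poly. lead_coeff p = 1 \<and> 1 \<le> degree p \<and> poly (map_poly \<iota> p) b = 0}.
      enat (degree p))"

definition integral_degree :: "('a::comm_ring_1 \<Rightarrow> 'b::comm_ring_1) \<Rightarrow> enat"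
  where "integral_degree \<iota> = (SUP b. elem_integral_degree \<iota> b)"

text \<open>The library's \<open>dim\<close> is \<open>0\<close> on infinite-dimensional spaces, hence the case distinction.\<close>

definition extension_degree :: "('k::field \<Rightarrow> 'l::field) \<Rightarrow> enat"
  where "extension_degree \<iota> =
    (if finite_extension \<iota> then enat (vector_space.dim (ext_scale \<iota>) UNIV) else \<infinity>)"

definition is_subfield :: "'l::field set \<Rightarrow> bool"
  where "is_subfield F \<longleftrightarrow> 0 \<in> F \<and> 1 \<in> F \<and>
    (\<forall>x\<in>F. \<forall>y\<in>F. x - y \<in> F \<and> x * y \<in> F) \<and> (\<forall>x\<in>F. inverse x \<in> F)"

text \<open>\<open>K(\<alpha>)\<close>, the smallest subfield of \<open>L\<close> containing \<open>K\<close> and \<open>\<alpha>\<close>.\<close>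

definition adjoin :: "('k::field \<Rightarrow> 'l::field) \<Rightarrow> 'l \<Rightarrow> 'l set"
  where "adjoin \<iota> \<alpha> = \<Inter>{F. is_subfield F \<and> range \<iota> \<subseteq> F \<and> \<alpha> \<in> F}"

definition simple_extension :: "('k::field \<Rightarrow> 'l::field) \<Rightarrow> bool"
  where "simple_extension \<iota> \<longleftrightarrow> (\<exists>\<alpha>. adjoin \<iota> \<alpha> = UNIV)"

text \<open>
  The embedding \<open>K \<subset> L\<close> of fraction fields induced by \<open>\<iota>\<close>, sending \<open>a / b\<close> to
  \<open>\<iota> a / \<iota> b\<close>. It is meaningful when \<open>\<iota>\<close> is a ring extension; see \<open>fract_ext_Fract\<close> and
  \<open>ring_extension_fract_ext\<close> below.
\<close>

definition fract_ext :: "('a::idom \<Rightarrow> 'b::idom) \<Rightarrow> 'a fract \<Rightarrow> 'b fract"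
  where "fract_ext \<iota> q = (THE r. \<exists>a b. b \<noteq> 0 \<and> q = Fract a b \<and> r = Fract (\<iota> a) (\<iota> b))"

lemma (in ring_extension) ext_zero: "\<iota> 0 = 0"
  using ext_add[of 0 0] by simp

lemma (in ring_extension) ext_eq_0_iff: "\<iota> x = 0 \<longleftrightarrow> x = 0"
  using ext_zero ext_inj by (metis injD)

lemma (in ring_extension) module_ext_scale: "module (ext_scale \<iota>)"
  by unfold_locales (simp_all add: ext_scale_def ext_add ext_mult ext_one algebra_simps)

lemma vector_space_ext_scale:
  fixes \<iota> :: "'k::field \<Rightarrow> 'l::field"
  assumes "ring_extension \<iota>"
  shows "vector_space (ext_scale \<iota>)"
proof -
  interpret ring_extension \<iota> by fact
  show ?thesis
    by unfold_locales (simp_all add: ext_scale_def ext_add ext_mult ext_one algebra_simps)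
qed

lemma fract_ext_Fract:
  fixes \<iota> :: "'a::idom \<Rightarrow> 'b::idom"
  assumes "ring_extension \<iota>" "b \<noteq> 0"
  shows "fract_ext \<iota> (Fract a b) = Fract (\<iota> a) (\<iota> b)"
proof -
  interpret ring_extension \<iota> by fact
  show ?thesis
    unfolding fract_ext_def
  proof (rule the_equality)
    show "\<exists>a' b'. b' \<noteq> 0 \<and> Fract a b = Fract a' b' \<and> Fract (\<iota> a) (\<iota> b) = Fract (\<iota> a') (\<iota> b')"
      using assms by blast
  next
    fix r assume "\<exists>a' b'. b' \<noteq> 0 \<and> Fract a b = Fract a' b' \<and> r = Fract (\<iota> a') (\<iota> b')"
    then obtain a' b' where *: "b' \<noteq> 0" "Fract a b = Fract a' b'" "r = Fract (\<iota> a') (\<iota> b')"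
      by blast
    then have "a * b' = a' * b"
      using assms by (simp add: eq_fract)
    then have "\<iota> a * \<iota> b' = \<iota> a' * \<iota> b"
      by (metis ext_mult)
    then show "r = Fract (\<iota> a) (\<iota> b)"
      using * assms by (simp add: eq_fract ext_eq_0_iff)
  qed
qed

lemma ring_extension_fract_ext:
  fixes \<iota> :: "'a::idom \<Rightarrow> 'b::idom"
  assumes "ring_extension \<iota>"
  shows "ring_extension (fract_ext \<iota>)"
proof -
  interpret ring_extension \<iota> by fact
  note F = fract_ext_Fract[OF assms]
  show ?thesis
  proof
    fix x y :: "'a fract"
    obtain a b where x: "x = Fract a b" "b \<noteq> 0" by (cases x) auto
    obtain c d where y: "y = Fract c d" "d \<noteq> 0" by (cases y) auto
    show "fract_ext \<iota> (x + y) = fract_ext \<iota> x + fract_ext \<iota> y"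
      using x y by (simp add: F ext_eq_0_iff ext_add ext_mult)
    show "fract_ext \<iota> (x * y) = fract_ext \<iota> x * fract_ext \<iota> y"
      using x y by (simp add: F ext_eq_0_iff ext_mult)
  next
    show "fract_ext \<iota> 1 = 1"
      by (simp add: One_fract_def F ext_one)
  next
    show "inj (fract_ext \<iota>)"
    proof (rule injI)
      fix x y assume xy: "fract_ext \<iota> x = fract_ext \<iota> y"
      obtain a b where x: "x = Fract a b" "b \<noteq> 0" by (cases x) auto
      obtain c d where y: "y = Fract c d" "d \<noteq> 0" by (cases y) auto
      have "\<iota> (a * d) = \<iota> (c * b)"
        using xy x y by (simp add: F ext_eq_0_iff ext_mult eq_fract)
      then have "a * d = c * b"
        using ext_inj by (metis injD)
      then show "x = y"
        using x y by (simp add: eq_fract)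
    qed
  qed
qed

end

theory Submission
  imports Defs Jordan_Normal_Form.Char_Poly
begin

text \<open>
  Generators of \<open>B\<close> over \<open>A\<close> span \<open>L\<close> over \<open>K\<close>, because integrality of \<open>B\<close> makes every nonzero
  element of \<open>B\<close> divide a nonzero element of \<open>A\<close>; and a subset of \<open>B\<close> is linearly independent
  over \<open>A\<close> iff it is so over \<open>K\<close>. Hence \<open>[L:K] \<le> \<mu>\<^sub>A(B)\<close>, and equality says exactly that a
  minimal generating set is a basis. For (b), \<open>d\<^sub>A(B) \<le> \<mu>\<^sub>A(B)\<close> by Cayley--Hamilton, and
  \<open>d\<^sub>K(L)\<close> is at most both \<open>d\<^sub>A(B)\<close> and \<open>[L:K]\<close>, with \<open>d\<^sub>K(L) = [L:K]\<close> iff \<open>L\<close> is simple over \<open>K\<close>.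
\<close>

no_notation fps_nth (infixl "$" 75)

section \<open>Attained infima and suprema of extended naturals\<close>

text \<open>Well-ordering of \<open>enat\<close> makes the infimum of a nonempty family a minimum;
  this turns the infima in the definitions into an actual polynomial or generating set.\<close>

lemma enat_INF_attained:
  fixes f :: "'c \<Rightarrow> enat"
  assumes "P \<noteq> {}"
  obtains p where "p \<in> P" "(INF p\<in>P. f p) = f p"
proof -
  obtain q where "q \<in> P"
    using assms by blast
  then have "Inf (f ` P) \<in> f ` P"
    by (intro wellorder_InfI[of "f q"] imageI)
  then show ?thesis
    using that by auto
qed

text \<open>An infinite set of extended naturals has supremum \<open>\<infinity>\<close>, so a
  finite supremum comes from a finite set of values and is their maximum.\<close>

lemma enat_SUP_attained:
  fixes f :: "'c \<Rightarrow> enat"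
  assumes "P \<noteq> {}" "(SUP p\<in>P. f p) = enat n"
  obtains p where "p \<in> P" "f p = enat n"
proof -
  have "finite (f ` P)"
    using assms by (auto simp: Sup_enat_def split: if_splits)
  then have "Sup (f ` P) \<in> f ` P"
    using assms(1) Max_in[of "f ` P"] by (simp add: Sup_enat_def)
  then show ?thesis
    using that assms(2) by auto
qed

section \<open>Integral degree and generating sets over a domain\<close>

locale domain_extension = ring_extension \<iota> for \<iota> :: "'a::idom \<Rightarrow> 'b::idom"
begin

sublocale inj_idom_hom \<iota>
  by unfold_locales (use ext_add ext_mult ext_one ext_zero ext_eq_0_iff in auto)

sublocale M: Modules.module "ext_scale \<iota>"
  by (rule module_ext_scale)

lemma span_finite_iff:
  assumes "finite S"
  shows "x \<in> M.span S \<longleftrightarrow> (\<exists>u. x = (\<Sum>s\<in>S. \<iota> (u s) * s))"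
  using assms by (auto simp: M.span_finite ext_scale_def)

lemma elem_integral_degree_le:
  assumes "lead_coeff p = 1" "1 \<le> degree p" "poly (map_poly \<iota> p) b = 0"
  shows "elem_integral_degree \<iota> b \<le> enat (degree p)"
  unfolding elem_integral_degree_def by (rule INF_lower) (use assms in auto)

lemma elem_integral_degree_attained:
  assumes "elem_integral_degree \<iota> b = enat n"
  obtains p where "lead_coeff p = 1" "1 \<le> degree p" "poly (map_poly \<iota> p) b = 0" "degree p = n"
proof -
  let ?P = "{p :: 'a poly. lead_coeff p = 1 \<and> 1 \<le> degree p \<and> poly (map_poly \<iota> p) b = 0}"
  have eq: "(INF p\<in>?P. enat (degree p)) = enat n"
    using assms unfolding elem_integral_degree_def .
  have "?P \<noteq> {}"
  \<comment> \<open>Were there no such polynomial, the infimum would be \<open>\<infinity>\<close>,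
    against the finite value \<open>n\<close>.\<close>
  proof
    assume "?P = {}"
    then have "(INF p\<in>?P. enat (degree p)) = \<infinity>"
      by (simp only: image_empty Inf_enat_def simp_thms if_True)
    with eq show False
      by simp
  qed
  then obtain p where p: "p \<in> ?P" "(INF p\<in>?P. enat (degree p)) = enat (degree p)"
    by (rule enat_INF_attained)
  have "degree p = n"
    using p(2) unfolding eq by simp
  with p(1) show ?thesis
    by (intro that[of p]) simp_all
qed

text \<open>
  If \<open>C\<close> is the matrix of multiplication by \<open>b\<close> in the generators, then the vector of generators is
  an eigenvector of \<open>C\<close> for the eigenvalue \<open>b\<close>, so \<open>b\<close> is a root of the characteristic polynomial.
\<close>

lemma monic_annihilator:
  assumes "finite S" "M.span S = UNIV"
  obtains p where "lead_coeff p = 1" "degree p = card S" "poly (map_poly \<iota> p) b = 0"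
proof -
  define n where "n = card S"
  obtain s where s: "bij_betw s {0..<n} S"
    using assms(1) ex_bij_betw_nat_finite n_def by blast
  have "\<exists>u. b * x = (\<Sum>t\<in>S. \<iota> (u t) * t)" for x
    using span_finite_iff[OF assms(1)] assms(2) by blast
  then obtain u where u: "\<And>x. b * x = (\<Sum>t\<in>S. \<iota> (u x t) * t)"
    by metis
  define C where "C = mat n n (\<lambda>(i, j). u (s i) (s j))"
  define v where "v = vec n s"
  have C: "C \<in> carrier_mat n n"
    by (simp add: C_def)
  have "map_mat \<iota> C *\<^sub>v v = b \<cdot>\<^sub>v v"
  proof (rule eq_vecI)
    fix i assume "i < dim_vec (b \<cdot>\<^sub>v v)"
    then have i: "i < n"
      by (simp add: v_def)
    have "(map_mat \<iota> C *\<^sub>v v) $ i = (\<Sum>j\<in>{0..<n}. \<iota> (u (s i) (s j)) * s j)"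
      using i by (simp add: C_def v_def scalar_prod_def)
    also have "\<dots> = (\<Sum>t\<in>S. \<iota> (u (s i) t) * t)"
      by (rule sum.reindex_bij_betw[OF s])
    also have "\<dots> = (b \<cdot>\<^sub>v v) $ i"
      using i by (simp add: u[symmetric] v_def)
    finally show "(map_mat \<iota> C *\<^sub>v v) $ i = (b \<cdot>\<^sub>v v) $ i" .
  qed (simp add: C_def v_def)
  \<comment> \<open>An eigenvector must be nonzero: if all generators vanished, so would
    \<open>1\<close>, which is a combination of them.\<close>
  moreover have "v \<noteq> 0\<^sub>v n"
  proof
    assume v0: "v = 0\<^sub>v n"
    have *: "t = 0" if "t \<in> S" for t
    proof -
      obtain i where "i < n" "t = s i"
        using s \<open>t \<in> S\<close> by (auto simp: bij_betw_def)
      then show ?thesis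
        using arg_cong[OF v0, of "\<lambda>w. w $ i"] by (simp add: v_def)
    qed
    obtain w where "1 = (\<Sum>t\<in>S. \<iota> (w t) * t)"
      using span_finite_iff[OF assms(1), of 1] assms(2) by auto
    also have "\<dots> = 0"
      by (rule sum.neutral) (use * in auto)
    finally show False
      by simp
  qed
  ultimately have ev: "eigenvector (map_mat \<iota> C) v b"
    using C by (simp add: eigenvector_def v_def)
  \<comment> \<open>Eigenvalues are identified with roots of the characteristic polynomial over the
    fraction field of B; injectivity of \<open>to_fract\<close> then brings the root back to
    B.\<close>
  interpret F: inj_idom_hom "to_fract :: 'b \<Rightarrow> 'b fract"
    by unfold_locales auto
  let ?D = "map_mat to_fract (map_mat \<iota> C) :: 'b fract mat"
  have C': "map_mat \<iota> C \<in> carrier_mat n n" and D: "?D \<in> carrier_mat n n"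
    using C by simp_all
  have "eigenvector ?D (map_vec to_fract v) (to_fract b)"
    by (rule F.eigenvector_hom[OF C' ev])
  then have "eigenvalue ?D (to_fract b)"
    unfolding eigenvalue_def by (rule exI)
  then have "poly (char_poly ?D) (to_fract b) = 0"
    unfolding eigenvalue_root_char_poly[OF D] .
  then have "to_fract (poly (map_poly \<iota> (char_poly C)) b) = 0"
    unfolding F.char_poly_hom[OF C'] char_poly_hom[OF C] F.poly_map_poly .
  then have "poly (map_poly \<iota> (char_poly C)) b = 0"
    unfolding to_fract_eq_0_iff .
  with degree_monic_char_poly[OF C] that[of "char_poly C"] show ?thesis
    by (simp add: n_def)
qed

lemma elem_integral_degree_le_card:
  assumes "finite S" "M.span S = UNIV"
  shows "elem_integral_degree \<iota> b \<le> enat (card S)"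
proof -
  obtain p where p: "lead_coeff p = 1" "degree p = card S" "poly (map_poly \<iota> p) b = 0"
    using monic_annihilator[OF assms] .
  have "1 \<le> degree p"
  \<comment> \<open>The definition asks for positive degree; a monic constant is \<open>1\<close>,
    which has no root.\<close>
  proof (rule ccontr)
    assume "\<not> 1 \<le> degree p"
    then have "degree p = 0"
      by simp
    then have "p = 1"
      using p(1) by (auto elim!: degree_eq_zeroE)
    with p(3) show False
      by simp
  qed
  with elem_integral_degree_le p show ?thesis
    by metis
qed

lemma integral_degree_le_min_generators: "integral_degree \<iota> \<le> min_generators \<iota>"
  unfolding integral_degree_def min_generators_def
  by (intro SUP_least INF_greatest) (use elem_integral_degree_le_card in auto)

lemma min_generators_attained:
  assumes "finite_extension \<iota>"
  obtains S where "finite S" "M.span S = UNIV" "min_generators \<iota> = enat (card S)"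
proof -
  let ?P = "{S. finite S \<and> M.span S = UNIV}"
  have "?P \<noteq> {}"
    using assms unfolding finite_extension_def by blast
  then obtain S where "S \<in> ?P" "min_generators \<iota> = enat (card S)"
    unfolding min_generators_def by (rule enat_INF_attained)
  then show ?thesis
    using that by blast
qed

lemma min_generators_le:
  assumes "finite S" "M.span S = UNIV"
  shows "min_generators \<iota> \<le> enat (card S)"
  unfolding min_generators_def by (rule INF_lower) (use assms in auto)

text \<open>Cancelling \<open>x\<close> from the relation until its constant term is nonzero leaves
  a multiple of \<open>x\<close> that is a nonzero constant. Over a field this yields the inverse of
  \<open>x\<close>; in B it moves denominators into A.\<close>

lemma algebraic_divides_constant:
  assumes "f \<noteq> 0" "poly (map_poly \<iota> f) x = 0" "x \<noteq> 0"
  shows "\<exists>g c. c \<noteq> 0 \<and> \<iota> c + x * poly (map_poly \<iota> g) x = 0"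
  using assms(1,2)
proof (induction f)
  case (pCons c g)
  have eq: "\<iota> c + x * poly (map_poly \<iota> g) x = 0"
    using pCons.prems by simp
  show ?case
  proof (cases "c = 0")
    case True
    then have "poly (map_poly \<iota> g) x = 0"
      using eq assms(3) by simp
    moreover have "g \<noteq> 0"
      using True pCons.hyps by simp
    ultimately show ?thesis
      by (rule pCons.IH[rotated])
  next
    case False
    then show ?thesis
      using eq by (intro exI[of _ g] exI[of _ c]) simp
  qed
qed simp

end

section \<open>Linear algebra of finite field extensions\<close>

locale field_extension = ring_extension \<iota> for \<iota> :: "'k::field \<Rightarrow> 'l::field"
begin

sublocale domain_extension \<iota> ..

sublocale field_hom \<iota> ..

sublocale V: vector_space "ext_scale \<iota>"
  by (rule vector_space_ext_scale) unfold_locales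

lemma finite_basis_exists:
  assumes "finite_extension \<iota>"
  obtains B where "finite B" "\<not> M.dependent B" "M.span B = UNIV"
    "extension_degree \<iota> = enat (card B)"
proof -
  obtain S where S: "finite S" "M.span S = UNIV"
    using assms by (auto simp: finite_extension_def)
  obtain B where B: "B \<subseteq> UNIV" "\<not> M.dependent B" "UNIV \<subseteq> M.span B" "card B = V.dim UNIV"
    by (rule V.basis_exists)
  have "finite B"
    using V.independent_span_bound[OF S(1) B(2)] S(2) by simp
  moreover have "M.span B = UNIV"
    using B(3) by blast
  moreover have "extension_degree \<iota> = enat (card B)"
    using assms B(4) by (simp add: extension_degree_def)
  ultimately show ?thesis
    using that B(2) by simp
qed

lemma extension_degree_eq_card:
  assumes "finite B" "\<not> M.dependent B" "M.span B = UNIV"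
  shows "extension_degree \<iota> = enat (card B)"
proof -
  have "finite_extension \<iota>"
    using assms by (auto simp: finite_extension_def)
  moreover have "V.dim UNIV = card B"
    by (rule V.dim_eq_card) (use assms in auto)
  ultimately show ?thesis
    by (simp add: extension_degree_def)
qed

text \<open>A spanning set contains a basis, which has [L:K] elements; if the set has no more than
  that, the basis exhausts it.\<close>

lemma independent_if_card_le_extension_degree:
  assumes "finite S" "M.span S = UNIV" "enat (card S) \<le> extension_degree \<iota>"
  shows "\<not> M.dependent S"
proof -
  obtain B where B: "B \<subseteq> S" "\<not> M.dependent B" "S \<subseteq> M.span B"
    using V.maximal_independent_subset[of S] .
  then have "finite B"
    using assms(1) finite_subset by blast
  moreover have "M.span B = UNIV"
    using M.span_minimal[OF B(3) M.subspace_span] assms(2) by blast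
  ultimately have "card S \<le> card B"
    using extension_degree_eq_card[of B] B(2) assms(3) by simp
  then have "B = S"
    using card_seteq[OF assms(1) B(1)] by blast
  with B(2) show ?thesis
    by simp
qed

lemma extension_degree_le_card:
  assumes "finite S" "M.span S = UNIV"
  shows "extension_degree \<iota> \<le> enat (card S)"
proof -
  have "finite_extension \<iota>"
    using assms by (auto simp: finite_extension_def)
  then show ?thesis
    using V.dim_le_card[of UNIV S] assms by (simp add: extension_degree_def)
qed

section \<open>Integral degree over a field and simple extensions\<close>

text \<open>Over a field, dividing by the leading coefficient makes any nonzero annihilator monic,
  and a nonzero constant annihilates nothing.\<close>

lemma elem_integral_degree_le_degree:
  assumes "q \<noteq> 0" "poly (map_poly \<iota> q) \<alpha> = 0"
  shows "elem_integral_degree \<iota> \<alpha> \<le> enat (degree q)"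
proof -
  let ?p = "Polynomial.smult (inverse (lead_coeff q)) q"
  have "elem_integral_degree \<iota> \<alpha> \<le> enat (degree ?p)"
  proof (rule elem_integral_degree_le)
    show "1 \<le> degree ?p"
    proof (rule ccontr)
      assume "\<not> 1 \<le> degree ?p"
      then have "degree q = 0"
        using assms(1) by simp
      then obtain c where "q = [:c:]"
        by (rule degree_eq_zeroE)
      with assms show False
        by simp
    qed
  qed (use assms in \<open>simp_all add: map_poly_hom_smult\<close>)
  then show ?thesis
    using assms(1) by simp
qed

lemma integral_degree_le_extension_degree:
  assumes "finite_extension \<iota>"
  shows "integral_degree \<iota> \<le> extension_degree \<iota>"
proof -
  obtain B where B: "finite B" "M.span B = UNIV" "extension_degree \<iota> = enat (card B)"
    using finite_basis_exists[OF assms] by metis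
  show ?thesis
    unfolding integral_degree_def B(3)
    by (rule SUP_least) (rule elem_integral_degree_le_card[OF B(1,2)])
qed

interpretation poly_hom: map_poly_comm_ring_hom \<iota> ..

text \<open>The values at \<open>\<alpha>\<close> of polynomials over K form a subfield
  \<open>F\<close>, which is all of L because \<open>\<alpha>\<close> generates L; remainders modulo
  \<open>p\<close> then suffice to represent every element.\<close>

lemma power_span_eq_UNIV_if_simple:
  assumes "finite_extension \<iota>" "adjoin \<iota> \<alpha> = UNIV"
    and p: "1 \<le> degree p" "poly (map_poly \<iota> p) \<alpha> = 0"
  shows "M.span ((\<lambda>i. \<alpha> ^ i) ` {..<degree p}) = UNIV"
proof -
  define F where "F = range (\<lambda>q. poly (map_poly \<iota> q) \<alpha>)"
  have F: "poly (map_poly \<iota> q) \<alpha> \<in> F" for q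
    by (simp add: F_def)
  obtain S where S: "finite S" "M.span S = UNIV"
    using assms(1) by (auto simp: finite_extension_def)
  have const: "\<iota> c \<in> F" for c
    using F[of "[:c:]"] unfolding map_poly_pCons_hom by simp
  have sub: "x - y \<in> F \<and> x * y \<in> F" if xy: "x \<in> F" "y \<in> F" for x y
  proof -
    obtain q r where "x = poly (map_poly \<iota> q) \<alpha>" "y = poly (map_poly \<iota> r) \<alpha>"
      using xy unfolding F_def by blast
    then show ?thesis
      using F[of "q - r"] F[of "q * r"] by (simp add: poly_hom.hom_minus poly_hom.hom_mult)
  qed
  \<comment> \<open>Finiteness enters here: \<open>x\<close> is algebraic, so
    \<open>x * g(x) = -c\<close> with \<open>c\<close> nonzero, and \<open>-g(x) / c\<close> is
    again a polynomial in \<open>\<alpha>\<close>.\<close>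
  have inv: "inverse x \<in> F" if "x \<in> F" for x
  proof (cases "x = 0")
    case True
    then show ?thesis
      using that by simp
  next
    case False
    obtain q where q: "x = poly (map_poly \<iota> q) \<alpha>"
      using \<open>x \<in> F\<close> unfolding F_def by blast
    obtain f where f: "lead_coeff f = 1" "poly (map_poly \<iota> f) x = 0"
      using monic_annihilator[OF S, of x] by metis
    have "f \<noteq> 0"
      using f(1) by auto
    obtain g c where gc: "c \<noteq> 0" "\<iota> c + x * poly (map_poly \<iota> g) x = 0"
      using algebraic_divides_constant[OF \<open>f \<noteq> 0\<close> f(2) False] by blast
    have "x * poly (map_poly \<iota> g) x = - \<iota> c"
      using gc(2) by (simp add: eq_neg_iff_add_eq_0 add.commute)
    moreover have "\<iota> c \<noteq> 0"
      using gc(1) by (simp add: ext_eq_0_iff)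
    ultimately have "inverse x = - inverse (\<iota> c) * poly (map_poly \<iota> g) x"
      using False by (simp add: field_simps)
    also have "\<dots> = poly (map_poly \<iota> (Polynomial.smult (- inverse c) (g \<circ>\<^sub>p q))) \<alpha>"
      unfolding map_poly_hom_smult map_poly_pcompose poly_smult poly_pcompose q
      by (simp add: hom_inverse hom_uminus)
    finally show ?thesis
      using F by metis
  qed
  have "is_subfield F"
    unfolding is_subfield_def using sub inv const[of 0] const[of 1] by (simp add: ext_zero ext_one)
  moreover have "\<alpha> \<in> F"
    using F[of "[:0, 1:]"] unfolding map_poly_pCons_hom by simp
  moreover have "range \<iota> \<subseteq> F"
    using const by blast
  ultimately have "F = UNIV"
    using assms(2) unfolding adjoin_def by blast
  have "x \<in> M.span ((\<lambda>i. \<alpha> ^ i) ` {..<degree p})" for x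
  proof -
    obtain q where q: "x = poly (map_poly \<iota> q) \<alpha>"
      using \<open>F = UNIV\<close> unfolding F_def by blast
    define r where "r = q mod p"
    have "p \<noteq> 0"
      using p(1) by auto
    then have deg: "degree r < degree p"
      using degree_mod_less[of p q] p(1) by (auto simp: r_def)
    have "q = q div p * p + r"
      by (simp add: r_def)
    then have "x = poly (map_poly \<iota> (q div p * p + r)) \<alpha>"
      using q by simp
    also have "\<dots> = poly (map_poly \<iota> r) \<alpha>"
      by (simp add: poly_hom.hom_add poly_hom.hom_mult p(2))
    also have "\<dots> = (\<Sum>i\<le>degree r. ext_scale \<iota> (coeff r i) (\<alpha> ^ i))"
      by (simp add: poly_altdef ext_scale_def)
    also have "\<dots> \<in> M.span ((\<lambda>i. \<alpha> ^ i) ` {..<degree p})"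
      using deg by (intro M.span_sum M.span_scale M.span_base) auto
    finally show ?thesis .
  qed
  then show ?thesis
    by (rule UNIV_eq_I[symmetric])
qed

lemma extension_degree_le_elem_integral_degree:
  assumes "finite_extension \<iota>" "adjoin \<iota> \<alpha> = UNIV"
  shows "extension_degree \<iota> \<le> elem_integral_degree \<iota> \<alpha>"
proof (cases "elem_integral_degree \<iota> \<alpha>")
  case (enat n)
  then obtain p where p: "1 \<le> degree p" "poly (map_poly \<iota> p) \<alpha> = 0" "degree p = n"
    by (rule elem_integral_degree_attained)
  have "extension_degree \<iota> \<le> enat (card ((\<lambda>i. \<alpha> ^ i) ` {..<degree p}))"
    by (rule extension_degree_le_card)
      (use power_span_eq_UNIV_if_simple[OF assms p(1,2)] in simp_all)
  also have "\<dots> \<le> enat n"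
    using card_image_le[of "{..<degree p}" "\<lambda>i. \<alpha> ^ i"] p(3) by simp
  finally show ?thesis
    using enat by simp
qed simp

text \<open>Every subfield containing K and \<open>\<alpha>\<close> is a K-subspace containing all
  powers of \<open>\<alpha>\<close>, hence contains their span.\<close>

lemma adjoin_eq_UNIV_if_span_powers:
  assumes "M.span ((\<lambda>i. \<alpha> ^ i) ` I) = UNIV"
  shows "adjoin \<iota> \<alpha> = UNIV"
proof -
  have "F = UNIV" if F: "is_subfield F" "range \<iota> \<subseteq> F" "\<alpha> \<in> F" for F
  proof -
    have closed: "0 \<in> F" "1 \<in> F" "\<And>x y. x \<in> F \<Longrightarrow> y \<in> F \<Longrightarrow> x - y \<in> F"
      "\<And>x y. x \<in> F \<Longrightarrow> y \<in> F \<Longrightarrow> x * y \<in> F"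
      using F(1) unfolding is_subfield_def by blast+
    have add: "x + y \<in> F" if "x \<in> F" "y \<in> F" for x y
      using closed(3)[OF that(1) closed(3)[OF closed(1) that(2)]] by simp
    have "M.subspace F"
    proof (rule M.subspaceI)
      show "ext_scale \<iota> c x \<in> F" if "x \<in> F" for c x
        unfolding ext_scale_def by (rule closed(4)[OF subsetD[OF F(2) rangeI] that])
    qed (fact closed add)+
    moreover have "\<alpha> ^ i \<in> F" for i
      by (induction i) (use closed F(3) in simp_all)
    then have "(\<lambda>i. \<alpha> ^ i) ` I \<subseteq> F"
      by (rule image_subsetI)
    ultimately have "M.span ((\<lambda>i. \<alpha> ^ i) ` I) \<subseteq> F"
      by (intro M.span_minimal)
    then show ?thesis
      by (simp add: assms top.extremum_unique)
  qed
  then show ?thesis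
    unfolding adjoin_def by auto
qed

text \<open>A linear relation among the powers is a polynomial of degree below \<open>n\<close>
  vanishing at \<open>\<alpha>\<close>. Injectivity is stated separately because the set of powers
  would merge equal ones.\<close>

lemma independent_powers:
  assumes "\<And>q. q \<noteq> 0 \<Longrightarrow> degree q < n \<Longrightarrow> poly (map_poly \<iota> q) \<alpha> \<noteq> 0"
  shows "inj_on (\<lambda>i. \<alpha> ^ i) {..<n}" "\<not> M.dependent ((\<lambda>i. \<alpha> ^ i) ` {..<n})"
proof -
  have lin: "u j = 0" if "(\<Sum>i<n. \<iota> (u i) * \<alpha> ^ i) = 0" "j < n" for u j
  proof (rule ccontr)
    assume "u j \<noteq> 0"
    define q where "q = (\<Sum>i<n. monom (u i) i)"
    have "coeff q j = u j"
      using that(2) by (simp add: q_def coeff_sum)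
    then have "q \<noteq> 0"
      using \<open>u j \<noteq> 0\<close> by auto
    moreover have "degree q < n"
      unfolding q_def using that(2) by (intro degree_sum_less) (auto intro: le_less_trans degree_monom_le)
    moreover have "poly (map_poly \<iota> q) \<alpha> = 0"
      using that(1) by (simp add: q_def poly_hom.hom_sum poly_sum poly_monom)
    ultimately show False
      using assms by blast
  qed
  show inj: "inj_on (\<lambda>i. \<alpha> ^ i) {..<n}"
  proof (rule inj_onI, rule ccontr)
    fix i j assume ij: "i \<in> {..<n}" "j \<in> {..<n}" "\<alpha> ^ i = \<alpha> ^ j" "i \<noteq> j"
    \<comment> \<open>These are the coefficients of \<open>T^i - T^j\<close>, which vanishes at
      \<open>\<alpha>\<close> when the two powers agree.\<close>
    let ?u = "\<lambda>k. if k = i then 1 else if k = j then - 1 else 0"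
    have "(\<Sum>k<n. \<iota> (?u k) * \<alpha> ^ k) = (\<Sum>k\<in>{i, j}. \<iota> (?u k) * \<alpha> ^ k)"
      using ij by (intro sum.mono_neutral_right) (auto simp: ext_zero)
    also have "\<dots> = 0"
      using ij by (simp add: ext_one hom_uminus)
    finally show False
      using lin[of ?u i] ij by simp
  qed
  show "\<not> M.dependent ((\<lambda>i. \<alpha> ^ i) ` {..<n})"
  proof
    assume "M.dependent ((\<lambda>i. \<alpha> ^ i) ` {..<n})"
    then obtain u j where u: "(\<Sum>v\<in>(\<lambda>i. \<alpha> ^ i) ` {..<n}. ext_scale \<iota> (u v) v) = 0"
      and j: "j < n" "u (\<alpha> ^ j) \<noteq> 0"
      by (auto simp: M.dependent_finite)
    have "(\<Sum>i<n. \<iota> (u (\<alpha> ^ i)) * \<alpha> ^ i) = 0"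
      using u by (simp add: sum.reindex[OF inj] ext_scale_def)
    with lin[of "\<lambda>i. u (\<alpha> ^ i)"] j show False
      by blast
  qed
qed

text \<open>By minimality of the degree, the first [L:K] powers of \<open>\<alpha>\<close> are
  independent; their number is the dimension, so they span L.\<close>

lemma simple_if_elem_integral_degree_eq_extension_degree:
  assumes "finite_extension \<iota>" "elem_integral_degree \<iota> \<alpha> = extension_degree \<iota>"
  shows "adjoin \<iota> \<alpha> = UNIV"
proof -
  obtain B where B: "finite B" "M.span B = UNIV" "extension_degree \<iota> = enat (card B)"
    using finite_basis_exists[OF assms(1)] by metis
  let ?P = "(\<lambda>i. \<alpha> ^ i) ` {..<card B}"
  have "poly (map_poly \<iota> q) \<alpha> \<noteq> 0" if "q \<noteq> 0" "degree q < card B" for q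
    using elem_integral_degree_le_degree[OF that(1), of \<alpha>] that(2) assms(2) B(3) by auto
  note indep = independent_powers[OF this]
  have "x \<in> M.span ?P" for x
  proof (rule ccontr)
    assume x: "x \<notin> M.span ?P"
    \<comment> \<open>An element outside the span would give an independent set with one element
      more than the basis \<open>B\<close>.\<close>
    then have "\<not> M.dependent (insert x ?P)"
      using indep(2) by (simp add: V.independent_insert)
    then have "card (insert x ?P) \<le> card B"
      using V.independent_span_bound[OF B(1), of "insert x ?P"] B(2) by simp
    moreover have "x \<notin> ?P"
    proof
      assume "x \<in> ?P"
      then have "x \<in> M.span ?P"
        by (rule M.span_base)
      with x show False
        by contradiction
    qed
    ultimately show False
      using card_image[OF indep(1)] by simp
  qed
  then have "M.span ?P = UNIV"
    by (rule UNIV_eq_I[symmetric])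
  then show ?thesis
    by (rule adjoin_eq_UNIV_if_span_powers)
qed

theorem simple_extension_iff_integral_degree:
  assumes "finite_extension \<iota>"
  shows "simple_extension \<iota> \<longleftrightarrow> integral_degree \<iota> = extension_degree \<iota>"
proof
  assume "simple_extension \<iota>"
  then obtain \<alpha> where "adjoin \<iota> \<alpha> = UNIV"
    by (auto simp: simple_extension_def)
  then have "extension_degree \<iota> \<le> elem_integral_degree \<iota> \<alpha>"
    by (rule extension_degree_le_elem_integral_degree[OF assms])
  also have "\<dots> \<le> integral_degree \<iota>"
    unfolding integral_degree_def by (rule SUP_upper) simp
  finally show "integral_degree \<iota> = extension_degree \<iota>"
    using integral_degree_le_extension_degree[OF assms] by simp
next
  assume eq: "integral_degree \<iota> = extension_degree \<iota>"
  obtain n where "extension_degree \<iota> = enat n"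
    using finite_basis_exists[OF assms] by metis
  with eq have "(SUP \<alpha>. elem_integral_degree \<iota> \<alpha>) = enat n"
    unfolding integral_degree_def by simp
  \<comment> \<open>Since [L:K] is finite, the supremum is attained, and the element attaining it
    generates L.\<close>
  then obtain \<alpha> where "elem_integral_degree \<iota> \<alpha> = enat n"
    using enat_SUP_attained[of UNIV] by (metis UNIV_not_empty)
  then have "adjoin \<iota> \<alpha> = UNIV"
    using assms \<open>extension_degree \<iota> = enat n\<close>
    by (intro simple_if_elem_integral_degree_eq_extension_degree) simp_all
  then show "simple_extension \<iota>"
    by (auto simp: simple_extension_def)
qed

end

section \<open>Clearing denominators and passing to fraction fields\<close>

text \<open>The product of the finitely many denominators serves; it will turn a linear relation
  over K into one over A.\<close>

lemma common_denominator:
  fixes T :: "'c::idom fract set"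
  assumes "finite T"
  shows "\<exists>d. d \<noteq> 0 \<and> (\<forall>x\<in>T. \<exists>a. to_fract d * x = to_fract a)"
  using assms
proof (induction T)
  case empty
  show ?case
    by (intro exI[of _ 1]) simp
next
  case (insert x T)
  then obtain d where d: "d \<noteq> 0" "\<And>y. y \<in> T \<Longrightarrow> \<exists>a. to_fract d * y = to_fract a"
    by auto
  obtain a b where x: "x = Fract a b" "b \<noteq> 0"
    by (cases x) auto
  have "\<exists>a. to_fract (b * d) * y = to_fract a" if "y \<in> insert x T" for y
  proof (cases "y = x")
    case True
    have "to_fract (b * d) * x = to_fract (d * a)"
      using x by (simp add: to_fract_def eq_fract del: to_fract_mult)
    then show ?thesis
      using True by blast
  next
    case False
    then have "y \<in> T"
      using that by simp
    then obtain c where "to_fract d * y = to_fract c"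
      using d(2) by auto
    then have "to_fract (b * d) * y = to_fract (b * c)"
      by (simp add: mult.assoc)
    then show ?thesis
      by blast
  qed
  moreover have "b * d \<noteq> 0"
    using d(1) x(2) by simp
  ultimately show ?case
    by blast
qed

context domain_extension
begin

text \<open>Facts prefixed with \<open>K\<close> concern L over K, those prefixed with
  \<open>M\<close> concern B over A.\<close>

interpretation K: field_extension "fract_ext \<iota>"
  by (intro field_extension.intro ring_extension_fract_ext ring_extension_axioms)

interpretation KA: inj_idom_hom "to_fract :: 'a \<Rightarrow> 'a fract"
  by unfold_locales auto

interpretation LB: inj_idom_hom "to_fract :: 'b \<Rightarrow> 'b fract"
  by unfold_locales auto

lemma fract_ext_to_fract: "fract_ext \<iota> (to_fract a) = to_fract (\<iota> a)"
  by (simp add: to_fract_def fract_ext_Fract[OF ring_extension_axioms] ext_one)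

lemma poly_fract_ext:
  "poly (map_poly (fract_ext \<iota>) (map_poly to_fract p)) (to_fract b) =
    to_fract (poly (map_poly \<iota> p) b)"
proof -
  have "map_poly (fract_ext \<iota>) (map_poly to_fract p) = map_poly to_fract (map_poly \<iota> p)"
    by (intro poly_eqI) (simp add: coeff_map_poly fract_ext_to_fract ext_zero K.ext_zero)
  then show ?thesis
    by simp
qed

text \<open>A denominator from B can be replaced by one from A, since by integrality it divides a
  nonzero element of A.\<close>

lemma clear_denominator:
  assumes "finite_extension \<iota>"
  obtains a b where "a \<noteq> 0" "fract_ext \<iota> (to_fract a) * x = to_fract b"
proof -
  obtain S where S: "finite S" "M.span S = UNIV"
    using assms by (auto simp: finite_extension_def)
  obtain c d where x: "x = Fract c d" "d \<noteq> 0"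
    by (cases x) auto
  obtain f where f: "lead_coeff f = 1" "poly (map_poly \<iota> f) d = 0"
    using monic_annihilator[OF S, of d] by metis
  have "f \<noteq> 0"
    using f(1) by auto
  obtain g e where e: "e \<noteq> 0" "\<iota> e + d * poly (map_poly \<iota> g) d = 0"
    using algebraic_divides_constant[OF \<open>f \<noteq> 0\<close> f(2) x(2)] by blast
  \<comment> \<open>The cofactor of \<open>d\<close> in \<open>\<iota> e\<close>, so that
    \<open>c / d\<close> equals \<open>h * c / \<iota> e\<close>.\<close>
  define h where "h = - poly (map_poly \<iota> g) d"
  have "\<iota> e = d * h"
    using e(2) by (simp add: h_def eq_neg_iff_add_eq_0)
  then have "fract_ext \<iota> (to_fract e) * x = to_fract (h * c)"
    using x unfolding fract_ext_to_fract by (simp add: to_fract_def eq_fract del: to_fract_mult)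
  with e(1) that show ?thesis
    by blast
qed

text \<open>Multiply \<open>x\<close> by a nonzero element of A to land in B, expand there in the
  generators, and divide again.\<close>

lemma span_to_fract:
  assumes "finite S" "M.span S = UNIV"
  shows "K.M.span (to_fract ` S) = UNIV"
proof (rule UNIV_eq_I[symmetric])
  fix x
  have "finite_extension \<iota>"
    using assms by (auto simp: finite_extension_def)
  then obtain a b where ab: "a \<noteq> 0" "fract_ext \<iota> (to_fract a) * x = to_fract b"
    by (rule clear_denominator)
  obtain u where u: "b = (\<Sum>s\<in>S. \<iota> (u s) * s)"
    using span_finite_iff[OF assms(1), of b] assms(2) by auto
  have "to_fract b = (\<Sum>s\<in>S. ext_scale (fract_ext \<iota>) (to_fract (u s)) (to_fract s))"
    unfolding u by (simp add: ext_scale_def fract_ext_to_fract LB.hom_sum)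
  also have "\<dots> \<in> K.M.span (to_fract ` S)"
    by (intro K.M.span_sum K.M.span_scale K.M.span_base imageI)
  finally have "ext_scale (fract_ext \<iota>) (inverse (to_fract a)) (to_fract b) \<in> K.M.span (to_fract ` S)"
    by (rule K.M.span_scale)
  also have "ext_scale (fract_ext \<iota>) (inverse (to_fract a)) (to_fract b) = x"
    unfolding ext_scale_def ab(2)[symmetric] using ab(1)
    by (simp add: K.hom_inverse K.ext_eq_0_iff mult.assoc[symmetric])
  finally show "x \<in> K.M.span (to_fract ` S)" .
qed

lemma finite_extension_fract_ext:
  assumes "finite_extension \<iota>"
  shows "finite_extension (fract_ext \<iota>)"
proof -
  obtain S where "finite S" "M.span S = UNIV"
    using assms by (auto simp: finite_extension_def)
  then show ?thesis
    unfolding finite_extension_def using span_to_fract by (intro exI[of _ "to_fract ` S"]) simp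
qed

text \<open>A relation over A is also one over K; conversely, a common denominator of its
  coefficients turns a relation over K into one over A.\<close>

lemma dependent_to_fract_iff: "K.M.dependent (to_fract ` S) \<longleftrightarrow> M.dependent S"
proof
  assume "M.dependent S"
  then obtain T u v where T: "finite T" "T \<subseteq> S" "(\<Sum>s\<in>T. ext_scale \<iota> (u s) s) = 0"
    "v \<in> T" "u v \<noteq> 0"
    unfolding M.dependent_explicit by blast
  \<comment> \<open>Coefficients must be indexed by elements of L, so \<open>u\<close> is
    transported along the inverse of the embedding of B.\<close>
  define w where "w x = to_fract (u (inv_into UNIV to_fract x))" for x :: "'b fract"
  have inj: "inj (to_fract :: 'b \<Rightarrow> 'b fract)"
    by (rule injI) simp
  have w: "w (to_fract s) = to_fract (u s)" for s
    by (simp add: w_def inv_into_f_f[OF inj])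
  have "(\<Sum>x\<in>to_fract ` T. ext_scale (fract_ext \<iota>) (w x) x) =
      (\<Sum>s\<in>T. ext_scale (fract_ext \<iota>) (to_fract (u s)) (to_fract s))"
    by (subst sum.reindex) (use inj in \<open>auto simp: w intro: inj_on_subset\<close>)
  also have "\<dots> = to_fract (\<Sum>s\<in>T. ext_scale \<iota> (u s) s)"
    by (simp add: ext_scale_def fract_ext_to_fract LB.hom_sum)
  finally have "(\<Sum>x\<in>to_fract ` T. ext_scale (fract_ext \<iota>) (w x) x) = 0"
    using T(3) by simp
  moreover have "w (to_fract v) \<noteq> 0"
    using T(5) by (simp add: w)
  ultimately show "K.M.dependent (to_fract ` S)"
    unfolding K.M.dependent_explicit
    by (intro exI[of _ "to_fract ` T"] exI[of _ w] conjI bexI[of _ "to_fract v"])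
      (use T in auto)
next
  assume "K.M.dependent (to_fract ` S)"
  then obtain T' w v' where T': "finite T'" "T' \<subseteq> to_fract ` S"
    "(\<Sum>x\<in>T'. ext_scale (fract_ext \<iota>) (w x) x) = 0" "v' \<in> T'" "w v' \<noteq> 0"
    unfolding K.M.dependent_explicit by blast
  obtain T where T: "T \<subseteq> S" "finite T" "T' = to_fract ` T"
    using finite_subset_image[OF T'(1,2)] by blast
  obtain v where v: "v \<in> T" "v' = to_fract v"
    using T'(4) T(3) by blast
  have "finite ((\<lambda>s. w (to_fract s)) ` T)"
    using T(2) by simp
  from common_denominator[OF this] obtain d where d: "d \<noteq> 0"
    "\<forall>s\<in>T. \<exists>a. to_fract d * w (to_fract s) = to_fract a"
    by auto
  from d(2) obtain u where u: "\<And>s. s \<in> T \<Longrightarrow> to_fract d * w (to_fract s) = to_fract (u s)"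
    by metis
  have "to_fract (\<Sum>s\<in>T. ext_scale \<iota> (u s) s) =
      (\<Sum>s\<in>T. fract_ext \<iota> (to_fract (u s)) * to_fract s)"
    by (simp add: ext_scale_def fract_ext_to_fract LB.hom_sum)
  also have "\<dots> = (\<Sum>s\<in>T. fract_ext \<iota> (to_fract d * w (to_fract s)) * to_fract s)"
    using u by simp
  also have "\<dots> = fract_ext \<iota> (to_fract d) *
      (\<Sum>s\<in>T. ext_scale (fract_ext \<iota>) (w (to_fract s)) (to_fract s))"
    by (simp add: K.ext_mult ext_scale_def sum_distrib_left mult.assoc)
  also have "(\<Sum>s\<in>T. ext_scale (fract_ext \<iota>) (w (to_fract s)) (to_fract s)) = 0"
    using T'(3) unfolding T(3) by (subst (asm) sum.reindex) (auto intro: inj_onI)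
  finally have "(\<Sum>s\<in>T. ext_scale \<iota> (u s) s) = 0"
    unfolding mult_zero_right to_fract_eq_0_iff .
  moreover have "to_fract (u v) \<noteq> 0"
    using u[OF v(1)] d(1) T'(5) v(2) by (metis mult_eq_0_iff to_fract_eq_0_iff)
  ultimately show "M.dependent S"
    unfolding M.dependent_explicit using T v(1)
    by (intro exI[of _ T] exI[of _ u] conjI bexI[of _ v]) simp_all
qed

lemma extension_degree_le_min_generators:
  assumes "finite_extension \<iota>"
  shows "extension_degree (fract_ext \<iota>) \<le> min_generators \<iota>"
proof -
  obtain S where S: "finite S" "M.span S = UNIV" "min_generators \<iota> = enat (card S)"
    using min_generators_attained[OF assms] .
  have "extension_degree (fract_ext \<iota>) \<le> enat (card (to_fract ` S))"
    using S span_to_fract by (intro K.extension_degree_le_card) simp_all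
  also have "\<dots> \<le> min_generators \<iota>"
    using S card_image_le by simp
  finally show ?thesis .
qed

section \<open>Freeness and simplicity by comparison of degrees\<close>

theorem free_extension_iff_extension_degree:
  assumes "finite_extension \<iota>"
  shows "free_extension \<iota> \<longleftrightarrow> extension_degree (fract_ext \<iota>) = min_generators \<iota>"
proof
  assume "free_extension \<iota>"
  then obtain T where T: "\<not> M.dependent T" "M.span T = UNIV"
    unfolding free_extension_def by auto
  obtain S where S: "finite S" "M.span S = UNIV"
    using assms by (auto simp: finite_extension_def)
  have indep: "\<not> K.M.dependent (to_fract ` T)"
    using T(1) by (simp add: dependent_to_fract_iff)
  have inj: "inj_on to_fract T"
    by (rule inj_onI) simp
  \<comment> \<open>Freeness only supplies some basis; it is finite because its image is independent
    in the finite-dimensional space L.\<close>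
  have "finite (to_fract ` T)"
    using K.V.independent_span_bound[of "to_fract ` S", OF _ indep] S span_to_fract[OF S] by simp
  then have "finite T"
    using inj by (rule finite_imageD)
  have "extension_degree (fract_ext \<iota>) = enat (card (to_fract ` T))"
    using \<open>finite T\<close> indep span_to_fract[OF \<open>finite T\<close> T(2)]
    by (intro K.extension_degree_eq_card) simp_all
  also have "\<dots> = enat (card T)"
    by (simp add: card_image[OF inj])
  finally have "min_generators \<iota> \<le> extension_degree (fract_ext \<iota>)"
    using min_generators_le[OF \<open>finite T\<close> T(2)] by simp
  then show "extension_degree (fract_ext \<iota>) = min_generators \<iota>"
    using extension_degree_le_min_generators[OF assms] by simp
next
  assume eq: "extension_degree (fract_ext \<iota>) = min_generators \<iota>"
  obtain S where S: "finite S" "M.span S = UNIV" "min_generators \<iota> = enat (card S)"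
    using min_generators_attained[OF assms] .
  \<comment> \<open>The image of a minimal generating set spans L and has at most [L:K] elements, so
    it is independent.\<close>
  have "\<not> K.M.dependent (to_fract ` S)"
  proof (rule K.independent_if_card_le_extension_degree)
    show "enat (card (to_fract ` S)) \<le> extension_degree (fract_ext \<iota>)"
      using card_image_le[OF S(1)] eq S(3) by simp
  qed (use S(1) span_to_fract[OF S(1,2)] in simp_all)
  then have "\<not> M.dependent S"
    by (simp add: dependent_to_fract_iff)
  then show "free_extension \<iota>"
    unfolding free_extension_def using S(2) by (intro exI[of _ S]) simp
qed

text \<open>If \<open>b\<close> is a root of \<open>p\<close> and \<open>x = b / a\<close>, then \<open>x\<close> is a root of \<open>p(aT)\<close>.\<close>

lemma integral_degree_fract_ext_le:
  assumes "finite_extension \<iota>"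
  shows "integral_degree (fract_ext \<iota>) \<le> integral_degree \<iota>"
  unfolding integral_degree_def
proof (rule SUP_mono)
  fix x
  obtain a b where ab: "a \<noteq> 0" "fract_ext \<iota> (to_fract a) * x = to_fract b"
    using assms by (rule clear_denominator)
  have "elem_integral_degree (fract_ext \<iota>) x \<le> elem_integral_degree \<iota> b"
  proof (cases "elem_integral_degree \<iota> b")
    case (enat n)
    then obtain p where p: "lead_coeff p = 1" "poly (map_poly \<iota> p) b = 0" "degree p = n"
      by (rule elem_integral_degree_attained)
    \<comment> \<open>As \<open>a\<close> is nonzero the substitution keeps the degree, but the
      leading coefficient becomes a power of \<open>a\<close>; hence the bound for annihilators that
      need not be monic is applied.\<close>
    define q where "q = map_poly to_fract p \<circ>\<^sub>p [:0, to_fract a:]"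
    have deg: "degree q = n"
      using ab(1) p(3) by (simp add: q_def degree_pcompose)
    have "p \<noteq> 0"
      using p(1) by auto
    then have "q \<noteq> 0"
      using ab(1) by (simp add: q_def pcompose_eq_0_iff)
    moreover have "poly (map_poly (fract_ext \<iota>) q) x =
        poly (map_poly (fract_ext \<iota>) (map_poly to_fract p)) (to_fract b)"
      using ab by (simp add: q_def K.map_poly_pcompose poly_pcompose mult.commute)
    then have "poly (map_poly (fract_ext \<iota>) q) x = 0"
      by (simp add: poly_fract_ext p(2))
    ultimately have "elem_integral_degree (fract_ext \<iota>) x \<le> enat (degree q)"
      by (rule K.elem_integral_degree_le_degree)
    then show ?thesis
      using enat deg by simp
  qed simp
  then show "\<exists>b\<in>UNIV. elem_integral_degree (fract_ext \<iota>) x \<le> elem_integral_degree \<iota> b"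
    by blast
qed

text \<open>The integral degree of L over K is at most that of B over A and at most [L:K], and both
  of these are at most the number of generators. Equality of the two ends of either chain forces
  equality throughout.\<close>

theorem free_and_simple_iff_integral_degree:
  assumes "finite_extension \<iota>"
  shows "free_extension \<iota> \<and> simple_extension (fract_ext \<iota>) \<longleftrightarrow>
    integral_degree (fract_ext \<iota>) = integral_degree \<iota> \<and> integral_degree \<iota> = min_generators \<iota>"
proof -
  note fin = finite_extension_fract_ext[OF assms]
  note le = integral_degree_fract_ext_le[OF assms] integral_degree_le_min_generators
    K.integral_degree_le_extension_degree[OF fin] extension_degree_le_min_generators[OF assms]
  show ?thesis
    unfolding free_extension_iff_extension_degree[OF assms]
      K.simple_extension_iff_integral_degree[OF fin]
    using le by auto
qed

end

theorem corollary5p3: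
  fixes \<iota> :: "'a::idom \<Rightarrow> 'b::idom"
  assumes "ring_extension \<iota>"
    and "finite_extension \<iota>"
  shows "(free_extension \<iota> \<longleftrightarrow> extension_degree (fract_ext \<iota>) = min_generators \<iota>) \<and>
    (free_extension \<iota> \<and> simple_extension (fract_ext \<iota>) \<longleftrightarrow>
      integral_degree (fract_ext \<iota>) = integral_degree \<iota> \<and>
      integral_degree \<iota> = min_generators \<iota>)"
proof -
  interpret domain_extension \<iota>
    by (intro domain_extension.intro assms(1))
  show ?thesis
    using free_extension_iff_extension_degree free_and_simple_iff_integral_degree assms(2)
    by simp
qed

end
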